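(* Let $G$ and $H$ be graphs. The join $G+H$ is a hangable graph if and only if either (1) $G+H$ is a complete graph, or (2) at most one vertex of $G+H$ is adjacent to every other vertex of $G+H$.
   Context: All graphs are finite, simple, undirected, with nonempty vertex set. For a connected graph $G=(V_G,E_G)$, $d_G(u,v)$ is the length of a shortest $u$--$v$ path. The eccentricity of $v$ is $e_G(v)=\max\{d_G(v,u): u\in V_G\}$ and the diameter is $d(G)=\max\{e_G(v): v\in V_G\}$. The periphery of a vertex $v$ is $P_G(v)=\{u\in V_G: d_G(v,u)=e_G(v)\}$; the periphery of $G$ is $P(G)=\{v\in V_G: e_G(v)=d(G)\}$. A connected graph $G$ is hangable if $P_G(v)\subseteq P(G)$ for every $v\in V_G$. The join $G+H$ is the graph obtained from the disjoint union of $G$ and $H$ by adding an edge between each vertex of $G$ and each vertex of $H$. *)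

theory Defs
  imports "Graph_Theory.Graph_Theory"
begin

text \<open>
  A finite simple undirected graph is a \<open>pair_graph\<close>: a finite loop-free digraph without
  parallel arcs whose arc relation is symmetric. That locale admits the null graph, so
  nonemptiness of the vertex set has to be assumed separately.

  The functions below are meant for connected, finite, nonempty graphs only; elsewhere the
  values of \<open>LEAST\<close> and \<open>Max\<close> are arbitrary.
\<close>

definition graph_dist :: "'a pair_pre_digraph \<Rightarrow> 'a \<Rightarrow> 'a \<Rightarrow> nat" where
  "graph_dist G u v = (LEAST n. \<exists>p. pre_digraph.apath (with_proj G) u p v \<and> length p = n)"

definition eccentricity :: "'a pair_pre_digraph \<Rightarrow> 'a \<Rightarrow> nat" where
  "eccentricity G v = Max {graph_dist G v u | u. u \<in> pverts G}"

definition graph_diameter :: "'a pair_pre_digraph \<Rightarrow> nat" where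
  "graph_diameter G = Max {eccentricity G v | v. v \<in> pverts G}"

definition vertex_periphery :: "'a pair_pre_digraph \<Rightarrow> 'a \<Rightarrow> 'a set" where
  "vertex_periphery G v = {u \<in> pverts G. graph_dist G v u = eccentricity G v}"

definition graph_periphery :: "'a pair_pre_digraph \<Rightarrow> 'a set" where
  "graph_periphery G = {v \<in> pverts G. eccentricity G v = graph_diameter G}"

text \<open>The name \<open>connected\<close> is qualified because HOL also has topological connectedness.\<close>

definition hangable :: "'a pair_pre_digraph \<Rightarrow> bool" where
  "hangable G \<longleftrightarrow> Digraph_Component.connected (with_proj G) \<and>
     (\<forall>v \<in> pverts G. vertex_periphery G v \<subseteq> graph_periphery G)"

text \<open>
  Tagging the vertices with \<open>Inl\<close> and \<open>Inr\<close> realises the disjoint union, whatever the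
  vertex sets of the two graphs are.
\<close>

definition graph_join ::
    "'a pair_pre_digraph \<Rightarrow> 'b pair_pre_digraph \<Rightarrow> ('a + 'b) pair_pre_digraph" where
  "graph_join G H = \<lparr>
     pverts = pverts G <+> pverts H,
     parcs = {(Inl u, Inl v) | u v. (u, v) \<in> parcs G}
           \<union> {(Inr u, Inr v) | u v. (u, v) \<in> parcs H}
           \<union> {(Inl u, Inr v) | u v. u \<in> pverts G \<and> v \<in> pverts H}
           \<union> {(Inr v, Inl u) | u v. u \<in> pverts G \<and> v \<in> pverts H}\<rparr>"

lemma pair_graph_graph_join:
  assumes "pair_graph G" and "pair_graph H"
  shows "pair_graph (graph_join G H)"
proof -
  interpret G: pair_graph G by fact
  interpret H: pair_graph H by fact
  have V: "finite (pverts (graph_join G H))"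
    by (simp add: graph_join_def)
  have sub: "parcs (graph_join G H) \<subseteq> pverts (graph_join G H) \<times> pverts (graph_join G H)"
    by (auto simp: graph_join_def dest: G.wellformed' H.wellformed')
  have sym: "symmetric (with_proj (graph_join G H))"
    by (auto simp: symmetric_def graph_join_def sym_def
        intro: G.arcs_symmetric H.arcs_symmetric)
  have irr: "fst e \<noteq> snd e" if "e \<in> parcs (graph_join G H)" for e
    using that by (auto simp: graph_join_def dest: G.no_loops' H.no_loops')
  show ?thesis
    using V sub sym irr finite_subset[OF sub]
    by unfold_locales auto
qed

definition universal_vertices :: "'a pair_pre_digraph \<Rightarrow> 'a set" where
  "universal_vertices G = {v \<in> pverts G. \<forall>u \<in> pverts G. u \<noteq> v \<longrightarrow> (v, u) \<in> parcs G}"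

definition complete_graph :: "'a pair_pre_digraph \<Rightarrow> bool" where
  "complete_graph G \<longleftrightarrow> complete_digraph (card (pverts G)) (with_proj G)"

end

theory Submission
  imports Defs
begin

text \<open>
  Any two vertices of a join are at distance at most two. In a graph with this property, the
  vertices of eccentricity one are exactly the universal ones, and all others have eccentricity
  two. If the graph is not complete, its periphery therefore consists of the non-universal
  vertices. A vertex at distance two from some other vertex is never universal, so only the
  periphery of a universal vertex, which consists of all other vertices, can violate hangability;
  it does so exactly when there is a second universal vertex.
\<close>

context pair_graph
begin

lemma graph_dist_self: "u \<in> pverts G \<Longrightarrow> graph_dist G u u = 0"
  unfolding graph_dist_def by (rule Least_eq_0) (auto simp: apath_Nil_iff)

lemma graph_dist_adj:
  assumes "(u, v) \<in> parcs G"
  shows "graph_dist G u v = 1"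
  unfolding graph_dist_def
proof (rule Least_equality)
  have "u \<noteq> v" "v \<in> pverts G"
    using assms no_loops'[of u v] in_arcsD2 by auto
  then have "apath u [(u, v)] v"
    using assms by (simp add: apath_simps)
  then show "\<exists>p. apath u p v \<and> length p = 1"
    by force
  show "1 \<le> n" if "\<exists>p. apath u p v \<and> length p = n" for n
    using that \<open>u \<noteq> v\<close> by (cases n) (auto simp: apath_Nil_iff)
qed

lemma graph_dist_common_neighbour:
  assumes "u \<noteq> v" "(u, v) \<notin> parcs G" "(u, w) \<in> parcs G" "(w, v) \<in> parcs G"
  shows "graph_dist G u v = 2"
  unfolding graph_dist_def
proof (rule Least_equality)
  have "u \<noteq> w" "w \<noteq> v" "v \<in> pverts G"
    using assms no_loops' in_arcsD2 by auto
  then have "apath u [(u, w), (w, v)] v"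
    using assms by (simp add: apath_simps)
  then show "\<exists>p. apath u p v \<and> length p = 2"
    by force
  show "2 \<le> n" if p: "\<exists>p. apath u p v \<and> length p = n" for n
  proof (rule ccontr)
    \<comment> \<open>A path with fewer than two arcs would force \<open>u = v\<close> or an arc
      from \<open>u\<close> to \<open>v\<close>.\<close>
    assume "\<not> 2 \<le> n"
    with p obtain p where "apath u p v" "p = [] \<or> (\<exists>e. p = [e])"
      by (auto simp: not_le less_2_cases_iff length_Suc_conv)
    with assms show False
      by (auto simp: apath_simps)
  qed
qed

text \<open>The vertex count required by \<open>complete_digraph\<close> holds by construction, so
  only the arc set matters, and one inclusion follows from well-formedness and the absence of
  loops.\<close>

lemma complete_graph_iff_universal:
  "complete_graph G \<longleftrightarrow> universal_vertices G = pverts G"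
proof -
  have "complete_graph G \<longleftrightarrow> parcs G = {(u, v). (u, v) \<in> pverts G \<times> pverts G \<and> u \<noteq> v}"
    by (simp add: complete_graph_def complete_digraph_pair_def pair_finite_verts)
  also have "\<dots> \<longleftrightarrow> (\<forall>u\<in>pverts G. \<forall>v\<in>pverts G. v \<noteq> u \<longrightarrow> (u, v) \<in> parcs G)"
    by (blast dest: no_loops' in_arcsD1 in_arcsD2)
  also have "\<dots> \<longleftrightarrow> universal_vertices G = pverts G"
    by (auto simp: universal_vertices_def)
  finally show ?thesis .
qed

text \<open>These two properties are all that the argument uses of a join, so the tagged sum type
  stays out of it until the end.\<close>

context
  assumes two_step: "\<And>u v. \<lbrakk>u \<in> pverts G; v \<in> pverts G; u \<noteq> v; (u, v) \<notin> parcs G\<rbrakk>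
      \<Longrightarrow> \<exists>w. (u, w) \<in> parcs G \<and> (w, v) \<in> parcs G"
    and nontrivial: "\<And>u. \<exists>v\<in>pverts G. v \<noteq> u"
begin

lemma graph_dist_eq:
  assumes "u \<in> pverts G" "v \<in> pverts G"
  shows "graph_dist G u v = (if u = v then 0 else if (u, v) \<in> parcs G then 1 else 2)"
  using assms two_step[of u v] graph_dist_self graph_dist_adj graph_dist_common_neighbour
  by auto

text \<open>\<open>nontrivial\<close> matters for the value 1: in a one-vertex graph the universal
  vertex has eccentricity 0.\<close>

lemma eccentricity_eq:
  assumes "v \<in> pverts G"
  shows "eccentricity G v = (if v \<in> universal_vertices G then 1 else 2)"
  unfolding eccentricity_def
proof (rule Max_eqI)
  show "finite {graph_dist G v u |u. u \<in> pverts G}"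
    using pair_finite_verts by simp
  show "d \<le> (if v \<in> universal_vertices G then 1 else 2)"
    if "d \<in> {graph_dist G v u |u. u \<in> pverts G}" for d
    using that assms by (auto simp: graph_dist_eq universal_vertices_def)
  \<comment> \<open>The maximum is attained at a non-neighbour of \<open>v\<close> if there is one,
    and at any other vertex if \<open>v\<close> is universal.\<close>
  obtain u where u: "u \<in> pverts G" "u \<noteq> v" "v \<notin> universal_vertices G \<Longrightarrow> (v, u) \<notin> parcs G"
    using assms nontrivial[of v] unfolding universal_vertices_def by blast
  then have "graph_dist G v u = (if v \<in> universal_vertices G then 1 else 2)"
    using assms by (auto simp: graph_dist_eq universal_vertices_def)
  with u(1) show "(if v \<in> universal_vertices G then 1 else 2) \<in> {graph_dist G v u |u. u \<in> pverts G}"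
    by force
qed

lemma graph_periphery_eq:
  "graph_periphery G =
    (if universal_vertices G = pverts G then pverts G else pverts G - universal_vertices G)"
proof (cases "universal_vertices G = pverts G")
  case True
  then have "{eccentricity G v |v. v \<in> pverts G} = {1}"
    using nontrivial eccentricity_eq by force
  then show ?thesis
    using True by (auto simp: graph_periphery_def graph_diameter_def eccentricity_eq)
next
  case False
  then obtain v where v: "v \<in> pverts G" "v \<notin> universal_vertices G"
    by (auto simp: universal_vertices_def)
  have "graph_diameter G = 2"
    unfolding graph_diameter_def
  proof (rule Max_eqI)
    show "finite {eccentricity G v |v. v \<in> pverts G}"
      using pair_finite_verts by simp
    show "d \<le> 2" if "d \<in> {eccentricity G v |v. v \<in> pverts G}" for d
      using that by (auto simp: eccentricity_eq)
    show "2 \<in> {eccentricity G v |v. v \<in> pverts G}"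
      using v eccentricity_eq[of v] by force
  qed
  with False show ?thesis
    by (auto simp: graph_periphery_def eccentricity_eq)
qed

lemma vertex_periphery_universal:
  assumes "v \<in> universal_vertices G"
  shows "vertex_periphery G v = pverts G - {v}"
proof -
  have "v \<in> pverts G"
    using assms by (simp add: universal_vertices_def)
  with assms show ?thesis
    by (auto simp: vertex_periphery_def graph_dist_eq eccentricity_eq universal_vertices_def)
qed

lemma vertex_periphery_nonuniversal:
  assumes "v \<in> pverts G" "v \<notin> universal_vertices G"
  shows "vertex_periphery G v \<subseteq> pverts G - universal_vertices G"
proof
  fix u
  assume u: "u \<in> vertex_periphery G v"
  then have "u \<in> pverts G" "v \<noteq> u" "(v, u) \<notin> parcs G"
    using assms by (auto simp: vertex_periphery_def eccentricity_eq graph_dist_eq split: if_splits)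
  \<comment> \<open>If \<open>u\<close> were universal, the arc from \<open>u\<close> to
    \<open>v\<close> could be reversed.\<close>
  with assms(1) show "u \<in> pverts G - universal_vertices G"
    using arcs_symmetric[of u v] unfolding universal_vertices_def by blast
qed

lemma connected_two_step: "Digraph_Component.connected (with_proj G)"
proof (rule connectedI)
  show "pverts G \<noteq> {}"
    using nontrivial by blast
  fix u v
  assume uv: "u \<in> pverts G" "v \<in> pverts G"
  have "u \<rightarrow>\<^sup>*\<^bsub>with_proj G\<^esub> v"
  proof (cases "u = v \<or> (u, v) \<in> parcs G")
    case False
    with uv two_step obtain w where "(u, w) \<in> parcs G" "(w, v) \<in> parcs G"
      by blast
    then show ?thesis
      by (blast intro: reachable_trans reachable_adjI)
  qed (use uv in auto)
  \<comment> \<open>Connectedness of a digraph refers to its symmetric closure, so reachability is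
    transferred there.\<close>
  then show "u \<rightarrow>\<^sup>*\<^bsub>mk_symmetric G\<^esub> v"
    by (rule reachable_mk_symmetricI)
qed

lemma hangable_iff_two_step:
  "hangable G \<longleftrightarrow> complete_graph G \<or> card (universal_vertices G) \<le> 1"
proof (cases "universal_vertices G = pverts G")
  case True
  \<comment> \<open>In a complete graph the periphery is the whole vertex set, so every inclusion is
    trivial.\<close>
  then show ?thesis
    by (auto simp: hangable_def complete_graph_iff_universal connected_two_step
        graph_periphery_eq vertex_periphery_def)
next
  case False
  let ?U = "universal_vertices G"
  have sub: "?U \<subseteq> pverts G"
    by (auto simp: universal_vertices_def)
  have "hangable G \<longleftrightarrow> (\<forall>v\<in>?U. pverts G - {v} \<subseteq> pverts G - ?U)"
  proof -
    have "hangable G \<longleftrightarrow> (\<forall>v\<in>pverts G. vertex_periphery G v \<subseteq> pverts G - ?U)"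
      using False by (simp add: hangable_def connected_two_step graph_periphery_eq)
    also have "\<dots> \<longleftrightarrow> (\<forall>v\<in>?U. vertex_periphery G v \<subseteq> pverts G - ?U)"
      using sub vertex_periphery_nonuniversal by blast
    finally show ?thesis
      by (simp add: vertex_periphery_universal)
  qed
  \<comment> \<open>A second universal vertex \<open>u\<close> lies in \<open>pverts G - {v}\<close>
    but is removed on the right-hand side.\<close>
  also have "\<dots> \<longleftrightarrow> (\<forall>v\<in>?U. \<forall>u\<in>?U. v = u)"
    using sub by blast
  also have "\<dots> \<longleftrightarrow> card ?U \<le> 1"
    using card_le_Suc0_iff_eq[of ?U] finite_subset[OF sub pair_finite_verts] by simp
  finally show ?thesis
    using False by (simp add: complete_graph_iff_universal)
qed

end

end

theorem theorem4:
  fixes G :: "'a pair_pre_digraph" and H :: "'b pair_pre_digraph"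
  assumes "pair_graph G" and "pverts G \<noteq> {}"
    and "pair_graph H" and "pverts H \<noteq> {}"
  shows "hangable (graph_join G H) \<longleftrightarrow>
    complete_graph (graph_join G H) \<or> card (universal_vertices (graph_join G H)) \<le> 1"
proof -
  interpret J: pair_graph "graph_join G H"
    using assms by (intro pair_graph_graph_join)
  obtain a b where ab: "a \<in> pverts G" "b \<in> pverts H"
    using assms by blast
  show ?thesis
  proof (rule J.hangable_iff_two_step)
    \<comment> \<open>Non-adjacent vertices lie on the same side of the join, so any vertex of the
      other side is adjacent to both.\<close>
    show "\<exists>w. (u, w) \<in> parcs (graph_join G H) \<and> (w, v) \<in> parcs (graph_join G H)"
      if "u \<in> pverts (graph_join G H)" "v \<in> pverts (graph_join G H)"
        "(u, v) \<notin> parcs (graph_join G H)" for u v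
    proof (cases u)
      case (Inl x)
      with that ab show ?thesis
        by (intro exI[of _ "Inr b"]) (auto simp: graph_join_def)
    next
      case (Inr y)
      with that ab show ?thesis
        by (intro exI[of _ "Inl a"]) (auto simp: graph_join_def)
    qed
    \<comment> \<open>A vertex of the side opposite to the tag of \<open>u\<close> differs from
      \<open>u\<close>.\<close>
    show "\<exists>v\<in>pverts (graph_join G H). v \<noteq> u" for u
      using ab by (cases u) (auto simp: graph_join_def)
  qed
qed

end
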